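(* Let $k$ and $m$ be positive integers and let $\ell_1,\ell_2,\ldots,\ell_k$ be positive integers. Let $U$ be a linear space over a field $\mathbb{F}$, and let $U_{ij}$ ($1\le i\le m$, $1\le j\le k$) be subspaces of $U$. Suppose that: (i) for every $1\le j\le k$ and $1\le i\le m$, $\dim U_{ij}\le \ell_j$; (ii) for every fixed $i$ with $1\le i\le m$, the subspaces $U_{i1},U_{i2},\ldots,U_{ik}$ are pairwise disjoint, i.e. $U_{ij}\cap U_{ij'}=\{0\}$ for all $j\neq j'$; (iii) for all $1\le i<i'\le m$, there exist $1\le j<j'\le k$ such that $U_{ij}\cap U_{i'j'}\neq\{0\}$. Then \[m\le \frac{\prod_{1\le a<b\le k}(\ell_a+\ell_b)!}{\left(\prod_{r=1}^k \ell_r!\right)^{k-1}}.\]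
   Context: The subspaces $U_{ij}$ are regarded as an $m\times k$ matrix of subspaces, with $i$ indexing rows and $j$ indexing columns. Two subspaces are called disjoint if their intersection is $\{0\}$. *)

theory Defs
  imports Complex_Main
begin

(* vector_space.dim returns 0 on subspaces without a finite basis, so an upper bound
   on dim is only meaningful together with finite-dimensionality. *)
definition dim_at_most :: "('f::field \<Rightarrow> 'v::ab_group_add \<Rightarrow> 'v) \<Rightarrow> 'v set \<Rightarrow> nat \<Rightarrow> bool"
  where "dim_at_most scale S n \<longleftrightarrow>
    (\<exists>B. finite B \<and> module.span scale B = S) \<and> vector_space.dim scale S \<le> n"

definition disjoint_subspaces :: "'v::zero set \<Rightarrow> 'v set \<Rightarrow> bool"
  where "disjoint_subspaces S T \<longleftrightarrow> S \<inter> T = {0}"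

end

theory Submission imports Defs "Jordan_Normal_Form.Determinant" begin

text \<open>
  Since every $\ell_r$ occurs in exactly $k - 1$ of the pairs $a < b$, the claimed bound equals
  $N = \prod_{a<b} {\ell_a + \ell_b \choose \ell_a}$.  It is a rank bound.  For each pair $a < b$ map
  the ambient space to a space of dimension exactly $\ell_a + \ell_b$ by a linear map so generic that,
  for every row $i$, it stays injective on $U_{ia} \oplus U_{ib}$.  Let $D_{ab}(i, i')$ be the
  determinant whose first $\ell_a$ rows are the images of a basis of $U_{ia}$ and whose other $\ell_b$
  rows are the images of a basis of $U_{i'b}$.  If $U_{ia}$ and $U_{i'b}$ meet nontrivially, the rows
  are dependent and $D_{ab}(i, i') = 0$; on the diagonal genericity makes $D_{ab}(i, i)$ nonzero.
  Hence the $m \times m$ matrix $\prod_{a<b} D_{ab}(i, i')$ has zeros above the diagonal and nonzero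
  diagonal entries, so its rank is $m$.
  
  On the other hand, Laplace expansion along the first $\ell_a$ rows writes $D_{ab}(i, i')$ as a sum,
  over the $\ell_a$-subsets $S$ of the columns, of a factor depending on $i$ times a factor depending
  on $i'$ (\<open>det_stack_eq_sum_of_products\<close>).  Multiplying these sums over all pairs factors the matrix
  through dimension $N$, so $m \le N$ (\<open>triangular_factorization_bound\<close>).  This is the argument with
  exterior powers and their tensor product, written in coordinates.
  
  Two points need care.  A generic map need not exist over a finite field, so the scalars are enlarged;
  the polynomial ring over the field already suffices, because everything works over an infinite
  integral domain (\<open>exists_generic_projection\<close>) and constant vectors keep their linear relations
  (\<open>independent_rows_const_poly\<close>).  And the dimension of $U_{ij}$ may be smaller than $\ell_j$, so each
  basis is filled up to length $\ell_j$ with new unit vectors, which are different for different columns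
  $j$ and thus create no new intersections (\<open>independent_padded_coords_iff\<close>).
\<close>

section \<open>Laplace expansion along several rows\<close>

lemma exists_permutation_onto:
  assumes S: "S \<subseteq> {0..<n}" and p: "card S = p"
  shows "\<exists>t. t permutes {0..<n} \<and> t ` {0..<p} = S"
proof -
  have fS: "finite S" using S finite_subset by blast
  have pn: "p \<le> n" using card_mono[OF _ S] p by simp
  obtain f where f: "bij_betw f {0..<p} S"
    using ex_bij_betw_nat_finite[OF fS] p by auto
  have "card {p..<n} = card ({0..<n} - S)"
    using card_Diff_subset[OF fS S] p by simp
  then obtain g where g: "bij_betw g {p..<n} ({0..<n} - S)"
    using finite_same_card_bij[of "{p..<n}" "{0..<n} - S"] by auto
  define t where "t x = (if x < p then f x else if x < n then g x else x)" for x
  have tf: "bij_betw t {0..<p} S"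
    using f by (rule bij_betw_cong[THEN iffD1, rotated]) (auto simp: t_def)
  have tg: "bij_betw t {p..<n} ({0..<n} - S)"
    using g by (rule bij_betw_cong[THEN iffD1, rotated]) (auto simp: t_def)
  have "bij_betw t ({0..<p} \<union> {p..<n}) (S \<union> ({0..<n} - S))"
    by (rule bij_betw_combine[OF tf tg]) auto
  moreover have "{0..<p} \<union> {p..<n} = {0..<n}" using pn by auto
  moreover have "S \<union> ({0..<n} - S) = {0..<n}" using S by auto
  ultimately have "bij_betw t {0..<n} {0..<n}" by simp
  then have "t permutes {0..<n}"
    by (rule bij_imp_permutes) (use pn in \<open>auto simp: t_def\<close>)
  moreover have "t ` {0..<p} = S" using tf by (simp add: bij_betw_def)
  ultimately show ?thesis by blast
qed

text \<open>
  The permutations that send the first $p$ rows to the columns in $t\{0,\dots,p-1\}$ are the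
  compositions of $t$ with the permutations preserving $\{0,\dots,p-1\}$.  The latter are exactly the
  ones that contribute to the determinant of the block diagonal matrix formed by the two minors.
\<close>

lemma sum_permutations_onto_eq_minors:
  fixes A B :: "nat \<Rightarrow> nat \<Rightarrow> 'a::idom" and p q :: nat
  defines "e \<equiv> \<lambda>r c. if r < p then A r c else B (r - p) c"
  assumes t: "t permutes {0..<p+q}"
  shows "(\<Sum>s\<in>{s. s permutes {0..<p+q} \<and> s ` {0..<p} = t ` {0..<p}}.
            signof s * (\<Prod>r=0..<p+q. e r (s r)))
       = signof t * det (mat p p (\<lambda>(r, c). A r (t c))) * det (mat q q (\<lambda>(r, c). B r (t (p + c))))"
    (is "?L = _")
proof -
  let ?P = "{s. s permutes {0..<p+q}}"
  define K where "K = four_block_mat (mat p p (\<lambda>(r, c). A r (t c))) (0\<^sub>m p q) (0\<^sub>m q p)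
     (mat q q (\<lambda>(r, c). B r (t (p + c))))"
  have K: "K \<in> carrier_mat (p+q) (p+q)" by (simp add: K_def carrier_matI)
  have Kin: "K $$ (r, c) = (if (r < p) = (c < p) then e r (t c) else 0)"
    if "r < p + q" "c < p + q" for r c
    using that by (auto simp: K_def e_def)
  \<comment> \<open>a permutation that leaves the diagonal blocks meets a zero of \<open>K\<close>\<close>
  have ent: "(\<Prod>r=0..<p+q. K $$ (r, s r)) = 
       (if s ` {0..<p} = {0..<p} then \<Prod>r=0..<p+q. e r (t (s r)) else 0)"
    if s: "s permutes {0..<p+q}" for s
  proof (cases "s ` {0..<p} = {0..<p}")
    case True
    have less: "s r < p + q" if "r < p + q" for r using permutes_in_image[OF s, of r] that by simp
    have "(r < p) = (s r < p)" if "r < p + q" for r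
    proof
      assume "s r < p"
      then have "s r \<in> s ` {0..<p}" using True by simp
      then show "r < p" using inj_image_mem_iff[OF permutes_inj[OF s]] by simp
    qed (use True in auto)
    then have "(\<Prod>r=0..<p+q. K $$ (r, s r)) = (\<Prod>r=0..<p+q. e r (t (s r)))"
      by (intro prod.cong) (auto simp: Kin less)
    then show ?thesis using True by simp
  next
    case False
    have "\<not> s ` {0..<p} \<subseteq> {0..<p}"
      using False endo_inj_surj[of "{0..<p}" s] inj_on_subset[OF permutes_inj[OF s]] by blast
    then obtain r where r: "r < p" "\<not> s r < p" by (metis atLeast0LessThan image_subset_iff lessThan_iff)
    then have "K $$ (r, s r) = 0" using permutes_in_image[OF s, of r] by (simp add: Kin)
    then have "(\<Prod>r=0..<p+q. K $$ (r, s r)) = 0" using r by (intro prod_zero) auto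
    then show ?thesis using False by simp
  qed
  have "det K = (\<Sum>s\<in>?P. signof s * (\<Prod>r=0..<p+q. K $$ (r, s r)))"
    by (rule det_def'[OF K])
  also have "\<dots> = (\<Sum>s\<in>?P. if s ` {0..<p} = {0..<p}
        then signof s * (\<Prod>r=0..<p+q. e r (t (s r))) else 0)"
    by (intro sum.cong) (auto simp: ent)
  also have "\<dots> = (\<Sum>s\<in>{s. s permutes {0..<p+q} \<and> s ` {0..<p} = {0..<p}}.
        signof s * (\<Prod>r=0..<p+q. e r (t (s r))))"
    by (simp add: sum.If_cases finite_permutations Int_def)
  finally have detK: "det K = \<dots>" .
  have "?L = (\<Sum>s\<in>{s. s permutes {0..<p+q} \<and> s ` {0..<p} = {0..<p}}.
        signof t * (signof s * (\<Prod>r=0..<p+q. e r (t (s r)))))"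
  proof (rule sum.reindex_bij_witness[where i = "\<lambda>s. t \<circ> s" and j = "\<lambda>s. inv_into UNIV t \<circ> s"], goal_cases)
    case (1 s) then show ?case using permutes_inverses[OF t] by (auto simp: fun_eq_iff)
  next
    case (2 s)
    then have "(inv_into UNIV t \<circ> s) ` {0..<p} = inv_into UNIV t ` t ` {0..<p}" by (simp only: image_comp[symmetric]) auto
    also have "\<dots> = {0..<p}" using permutes_inverses[OF t] by (simp add: image_image)
    finally show ?case using 2 permutes_compose[OF _ permutes_inv[OF t]] by auto
  next
    case (3 s) then show ?case using permutes_inverses[OF t] by (auto simp: fun_eq_iff)
  next
    case (4 s)
    then have "(t \<circ> s) ` {0..<p} = t ` {0..<p}" by (simp only: image_comp[symmetric]) auto
    then show ?case using 4 permutes_compose[OF _ t] by auto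
  next
    case (5 s)
    have s: "s permutes {0..<p+q}" using 5 by simp
    have i: "inv_into UNIV t permutes {0..<p+q}" by (rule permutes_inv[OF t])
    have "permutation s" "permutation t" "permutation (inv_into UNIV t)"
      using s t i permutation_permutes by blast+
    then have "sign t * sign (inv_into UNIV t \<circ> s) = sign s"
      by (simp add: sign_compose sign_inverse sign_idempotent mult.assoc[symmetric])
    then have "signof t * (signof (inv_into UNIV t \<circ> s)) = (signof s :: 'a)"
      by (metis of_int_mult)
    then show ?case using permutes_inverses[OF t] by (simp add: mult.assoc[symmetric])
  qed
  also have "\<dots> = signof t * det K" by (simp add: detK sum_distrib_left)
  also have "det K = det (mat p p (\<lambda>(r, c). A r (t c))) * det (mat q q (\<lambda>(r, c). B r (t (p + c))))"
    unfolding K_def by (rule det_four_block_mat_upper_right_zero) auto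
  finally show ?thesis by (simp add: mult.assoc)
qed

text \<open>
  Only the shape of the expansion matters later: for each column set $S$, one factor that sees the top
  rows $A$ alone and one that sees the bottom rows $B$ alone.  The number ${p+q \choose p}$ of column
  sets is where the binomial coefficients of the final bound come from.
\<close>

lemma det_stack_eq_sum_of_products:
  "\<exists>(u :: (nat \<Rightarrow> nat \<Rightarrow> 'a::idom) \<Rightarrow> nat set \<Rightarrow> 'a) v. \<forall>A B.
     det (mat (p+q) (p+q) (\<lambda>(r, c). if r < p then A r c else B (r - p) c))
     = (\<Sum>S\<in>{S. S \<subseteq> {0..<p+q} \<and> card S = p}. u A S * v B S)"
proof -
  let ?F = "{S. S \<subseteq> {0..<p+q} \<and> card S = p}"
  let ?P = "{s. s permutes {0..<p+q}}"
  obtain t where t: "\<And>S. S \<in> ?F \<Longrightarrow> t S permutes {0..<p+q} \<and> t S ` {0..<p} = S"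
    using exists_permutation_onto[of _ "p+q" p] by (metis (mono_tags, lifting) mem_Collect_eq)
  define u :: "(nat \<Rightarrow> nat \<Rightarrow> 'a) \<Rightarrow> nat set \<Rightarrow> 'a"
    where "u A S = signof (t S) * det (mat p p (\<lambda>(r, c). A r (t S c)))" for A S
  define v :: "(nat \<Rightarrow> nat \<Rightarrow> 'a) \<Rightarrow> nat set \<Rightarrow> 'a"
    where "v B S = det (mat q q (\<lambda>(r, c). B r (t S (p + c))))" for B S
  have "det (mat (p+q) (p+q) (\<lambda>(r, c). if r < p then A r c else B (r - p) c))
     = (\<Sum>S\<in>?F. u A S * v B S)" for A B
  proof -
    let ?e = "\<lambda>r c. if r < p then A r c else B (r - p) c"
    have "det (mat (p+q) (p+q) (\<lambda>(r, c). ?e r c))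
       = (\<Sum>s\<in>?P. signof s * (\<Prod>r=0..<p+q. mat (p+q) (p+q) (\<lambda>(r, c). ?e r c) $$ (r, s r)))"
      by (rule det_def') simp
    also have "\<dots> = (\<Sum>s\<in>?P. signof s * (\<Prod>r=0..<p+q. ?e r (s r)))"
    proof (rule sum.cong[OF refl])
      fix s assume "s \<in> ?P"
      then have "s r < p + q" if "r < p + q" for r using permutes_in_image[of s "{0..<p+q}" r] that by simp
      then have "(\<Prod>r=0..<p+q. mat (p+q) (p+q) (\<lambda>(r, c). ?e r c) $$ (r, s r)) = (\<Prod>r=0..<p+q. ?e r (s r))"
        by (intro prod.cong) auto
      then show "signof s * (\<Prod>r=0..<p+q. mat (p+q) (p+q) (\<lambda>(r, c). ?e r c) $$ (r, s r))
          = signof s * (\<Prod>r=0..<p+q. ?e r (s r))" by simp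
    qed
    also have "\<dots> = (\<Sum>S\<in>?F. \<Sum>s\<in>{s \<in> ?P. s ` {0..<p} = S}. signof s * (\<Prod>r=0..<p+q. ?e r (s r)))"
    proof (rule sum.group[symmetric])
      show "(\<lambda>s. s ` {0..<p}) ` ?P \<subseteq> ?F"
      proof clarsimp
        fix s assume s: "s permutes {0..<p+q}"
        have "card (s ` {0..<p}) = p" 
          using card_image[OF inj_on_subset[OF permutes_inj[OF s]], of "{0..<p}"] by simp
        moreover have "s ` {0..<p} \<subseteq> s ` {0..<p+q}" by (rule image_mono) auto
        then have "s ` {0..<p} \<subseteq> {0..<p+q}" by (simp only: permutes_image[OF s])
        ultimately show "s ` {0..<p} \<subseteq> {0..<p+q} \<and> card (s ` {0..<p}) = p" by blast
      qed
    qed (auto simp: finite_permutations)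
    also have "\<dots> = (\<Sum>S\<in>?F. u A S * v B S)"
    proof (rule sum.cong[OF refl])
      fix S assume "S \<in> ?F"
      then have tS: "t S permutes {0..<p+q}" "t S ` {0..<p} = S" using t by auto
      show "(\<Sum>s\<in>{s \<in> ?P. s ` {0..<p} = S}. signof s * (\<Prod>r=0..<p+q. ?e r (s r))) = u A S * v B S"
        using sum_permutations_onto_eq_minors[OF tS(1), of A B] by (simp add: tS(2) u_def v_def)
    qed
    finally show ?thesis .
  qed
  then show ?thesis by blast
qed

section \<open>Rank bound\<close>

text \<open>
  A triangular matrix with nonzero diagonal has nonzero determinant, but a product of an $m \times r$
  and an $r \times m$ matrix with $r < m$ has determinant zero: fill both factors up to square matrices
  with zero columns and zero rows.
\<close>

lemma triangular_factorization_bound: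
  fixes x :: "nat \<Rightarrow> 's \<Rightarrow> 'a::idom"
  assumes fin: "finite I"
    and diag: "\<And>i. i < m \<Longrightarrow> (\<Sum>s\<in>I. x i s * y s i) \<noteq> 0"
    and upper: "\<And>i j. i < j \<Longrightarrow> j < m \<Longrightarrow> (\<Sum>s\<in>I. x i s * y s j) = 0"
  shows "m \<le> card I"
proof (rule ccontr)
  assume "\<not> m \<le> card I"
  then have lt: "card I < m" by simp
  obtain e where e: "bij_betw e {0..<card I} I" using ex_bij_betw_nat_finite[OF fin] by blast
  define X where "X = mat m m (\<lambda>(i, s). if s < card I then x i (e s) else 0)"
  define Y where "Y = mat m m (\<lambda>(s, j). if s < card I then y (e s) j else 0)"
  have XY: "X \<in> carrier_mat m m" "Y \<in> carrier_mat m m" by (auto simp: X_def Y_def)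
  have ent: "(X * Y) $$ (i, j) = (\<Sum>s\<in>I. x i s * y s j)" if "i < m" "j < m" for i j
  proof -
    have "(X * Y) $$ (i, j) = (\<Sum>s=0..<m. if s < card I then x i (e s) * y (e s) j else 0)"
      using that by (auto simp: X_def Y_def scalar_prod_def intro!: sum.cong)
    also have "\<dots> = (\<Sum>s=0..<card I. x i (e s) * y (e s) j)"
      using lt by (intro sum.mono_neutral_cong_right) auto
    also have "\<dots> = (\<Sum>s\<in>I. x i s * y s j)" by (rule sum.reindex_bij_betw[OF e])
    finally show ?thesis .
  qed
  have "det X = 0"
    using lt by (subst laplace_expansion_column[OF XY(1) lt]) (auto simp: X_def intro!: sum.neutral)
  then have "det (X * Y) = 0" by (simp add: det_mult[OF XY])
  moreover have "det (X * Y) = prod_list (diag_mat (X * Y))"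
    using XY by (intro det_lower_triangular[of m]) (simp_all add: ent upper del: index_mult_mat)
  moreover have "prod_list (diag_mat (X * Y)) = (\<Prod>i=0..<m. (X * Y) $$ (i, i))"
    using XY by (simp add: prod_list_diag_prod)
  ultimately show False using diag by (auto simp: ent simp del: index_mult_mat)
qed

section \<open>Generic projections\<close>

text \<open>
  Choose the coordinates of $f$ one at a time.  A vector whose $d$-th entry is nonzero excludes at most
  one value for $f(d)$; a vector whose $d$-th entry is zero has been dealt with already.
\<close>

lemma exists_functional_avoiding:
  fixes w :: "'j \<Rightarrow> 'c \<Rightarrow> 'a::idom"
  assumes inf: "infinite (UNIV :: 'a set)" and J: "finite J" and C: "finite C"
    and nz: "\<And>j. j \<in> J \<Longrightarrow> \<exists>c\<in>C. w j c \<noteq> 0"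
  shows "\<exists>f. \<forall>j\<in>J. (\<Sum>c\<in>C. w j c * f c) \<noteq> 0"
  using C J nz
proof (induction C arbitrary: J)
  case empty
  then show ?case by auto
next
  case (insert d C)
  let ?J = "{j \<in> J. w j d = 0}"
  obtain f where f: "\<forall>j\<in>?J. (\<Sum>c\<in>C. w j c * f c) \<noteq> 0"
    using insert.IH[of ?J] insert.prems by auto
  have "finite (\<Union>j\<in>J - ?J. {x. w j d * x + (\<Sum>c\<in>C. w j c * f c) = 0})"
  proof (rule finite_UN_I)
    show "finite (J - ?J)" using insert.prems by simp
    fix j assume j: "j \<in> J - ?J"
    have "x = x'" if "w j d * x + a = 0" "w j d * x' + a = 0" for x x' a
    proof -
      have "w j d * x = w j d * x'" using that by (metis add_right_cancel)
      then show ?thesis using j insert.prems by auto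
    qed
    then have "{x. w j d * x + a = 0} \<subseteq> {y}" if "w j d * y + a = 0" for y a
      using that by auto
    then show "finite {x. w j d * x + (\<Sum>c\<in>C. w j c * f c) = 0}"
      by (cases "\<exists>y. w j d * y + (\<Sum>c\<in>C. w j c * f c) = 0") (auto intro: finite_subset)
  qed
  then obtain x where x: "x \<notin> (\<Union>j\<in>J - ?J. {x. w j d * x + (\<Sum>c\<in>C. w j c * f c) = 0})"
    using ex_new_if_finite[OF inf] by blast
  have s: "(\<Sum>c\<in>C. w j c * (f(d := x)) c) = (\<Sum>c\<in>C. w j c * f c)" for j
    using insert.hyps by (intro sum.cong) auto
  have "\<forall>j\<in>J. (\<Sum>c\<in>insert d C. w j c * (f(d := x)) c) \<noteq> 0"
    using f x insert.hyps s by auto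
  then show ?case by blast
qed

text \<open>
  Linear independence of $n$ coordinate vectors, stated for a sequence and over a ring so that it can be
  used over the field and over its polynomial ring alike.
\<close>

definition independent_rows :: "nat \<Rightarrow> 'c set \<Rightarrow> (nat \<Rightarrow> 'c \<Rightarrow> 'a::comm_ring_1) \<Rightarrow> bool"
  where "independent_rows n C x \<longleftrightarrow>
    (\<forall>\<alpha>. (\<forall>c\<in>C. (\<Sum>s<n. \<alpha> s * x s c) = 0) \<longrightarrow> (\<forall>s<n. \<alpha> s = 0))"

text \<open>
  The linear functionals $\Phi_0, \dots, \Phi_{n-1}$ together are a projection to dimension $n$; the rows
  of this matrix are the projected vectors.
\<close>

definition projected_mat :: "nat \<Rightarrow> 'c set \<Rightarrow> (nat \<Rightarrow> 'c \<Rightarrow> 'a::comm_ring_1) \<Rightarrow> (nat \<Rightarrow> 'c \<Rightarrow> 'a) \<Rightarrow> 'a mat"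
  where "projected_mat n C x \<Phi> = mat n n (\<lambda>(s, r). \<Sum>c\<in>C. x s c * \<Phi> r c)"

lemma projected_mat_carrier [simp]: "projected_mat n C x \<Phi> \<in> carrier_mat n n"
  by (simp add: projected_mat_def)

lemma independent_rows_lower:
  assumes "independent_rows (Suc n) C x"
  shows "independent_rows n C x"
  unfolding independent_rows_def
proof (intro allI impI)
  fix \<alpha> s assume z: "\<forall>c\<in>C. (\<Sum>s<n. \<alpha> s * x s c) = 0" and s: "s < n"
  have "(\<Sum>s<Suc n. (\<alpha>(n := 0)) s * x s c) = (\<Sum>s<n. \<alpha> s * x s c)" for c
    by (simp add: sum.lessThan_Suc)
  with z have "\<forall>c\<in>C. (\<Sum>s<Suc n. (\<alpha>(n := 0)) s * x s c) = 0" by simp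
  with assms s have "(\<alpha>(n := 0)) s = 0" unfolding independent_rows_def
    using less_SucI by blast
  then show "\<alpha> s = 0" using s by simp
qed

text \<open>
  Induction on $n$, adding one functional $f$.  By expansion along the last column, the determinant is
  $f(w_j)$, where $w_j$ is the combination of the rows of $x_j$ with the cofactors as coefficients.  Its
  last coefficient is the determinant from the induction hypothesis, which is nonzero, so $w_j \ne 0$ by
  independence, and a functional that vanishes on none of the finitely many $w_j$ can be chosen.
\<close>

lemma exists_generic_projection:
  fixes x :: "'j \<Rightarrow> nat \<Rightarrow> 'c \<Rightarrow> 'a::idom"
  assumes inf: "infinite (UNIV :: 'a set)" and J: "finite J" and C: "finite C"
    and ind: "\<And>j. j \<in> J \<Longrightarrow> independent_rows n C (x j)"
  shows "\<exists>\<Phi>. \<forall>j\<in>J. det (projected_mat n C (x j) \<Phi>) \<noteq> 0"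
  using ind
proof (induction n)
  case 0
  then show ?case by (simp add: projected_mat_def)
next
  case (Suc n)
  obtain \<Phi> where \<Phi>: "\<forall>j\<in>J. det (projected_mat n C (x j) \<Phi>) \<noteq> 0"
    using Suc independent_rows_lower by blast
  define \<gamma> where "\<gamma> j s = cofactor (projected_mat (Suc n) C (x j) \<Phi>) s n" for j s
  define w where "w j c = (\<Sum>s<Suc n. \<gamma> j s * x j s c)" for j c
  \<comment> \<open>deleting the last row and column leaves the matrix of the induction hypothesis\<close>
  have "\<gamma> j n = det (projected_mat n C (x j) \<Phi>)" for j
  proof -
    have "mat_delete (projected_mat (Suc n) C (x j) \<Phi>) n n = projected_mat n C (x j) \<Phi>"
      by (rule eq_matI) (auto simp: projected_mat_def mat_delete_def)
    then show ?thesis by (simp add: \<gamma>_def cofactor_def)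
  qed
  with \<Phi> have "\<exists>c\<in>C. w j c \<noteq> 0" if "j \<in> J" for j
    using that Suc.prems[OF that] unfolding independent_rows_def w_def by (metis lessI)
  then obtain f where f: "\<forall>j\<in>J. (\<Sum>c\<in>C. w j c * f c) \<noteq> 0"
    using exists_functional_avoiding[OF inf J C, of w] by blast
  have "det (projected_mat (Suc n) C (x j) (\<Phi>(n := f))) = (\<Sum>c\<in>C. w j c * f c)" for j
  proof -
    let ?M = "projected_mat (Suc n) C (x j) (\<Phi>(n := f))"
    \<comment> \<open>cofactors of the last column do not involve the new functional\<close>
    have cof: "cofactor ?M s n = \<gamma> j s" if "s < Suc n" for s
    proof -
      have "mat_delete ?M s n = mat_delete (projected_mat (Suc n) C (x j) \<Phi>) s n"
        using that by (intro eq_matI) (auto simp: projected_mat_def mat_delete_def)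
      then show ?thesis by (simp add: \<gamma>_def cofactor_def)
    qed
    have "det ?M = (\<Sum>s<Suc n. ?M $$ (s, n) * cofactor ?M s n)"
      by (rule laplace_expansion_column[of _ "Suc n"]) auto
    also have "\<dots> = (\<Sum>s<Suc n. (\<Sum>c\<in>C. x j s c * f c) * \<gamma> j s)"
    proof (rule sum.cong[OF refl])
      fix s assume "s \<in> {..<Suc n}"
      then have "s < Suc n" by simp
      moreover from this have "?M $$ (s, n) = (\<Sum>c\<in>C. x j s c * f c)"
        by (simp add: projected_mat_def)
      ultimately show "?M $$ (s, n) * cofactor ?M s n = (\<Sum>c\<in>C. x j s c * f c) * \<gamma> j s"
        by (simp only: cof)
    qed
    also have "\<dots> = (\<Sum>s<Suc n. \<Sum>c\<in>C. \<gamma> j s * x j s c * f c)"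
      by (simp add: sum_distrib_left mult_ac del: sum.lessThan_Suc)
    also have "\<dots> = (\<Sum>c\<in>C. w j c * f c)"
      unfolding w_def sum_distrib_right by (rule sum.swap)
    finally show ?thesis .
  qed
  with f show ?case by (intro exI[of _ "\<Phi>(n := f)"]) (simp del: fun_upd_apply)
qed

lemma det_projected_mat_dependent:
  fixes x :: "nat \<Rightarrow> 'c \<Rightarrow> 'a::idom"
  assumes dep: "\<not> independent_rows n C x"
  shows "det (projected_mat n C x \<Phi>) = 0"
proof -
  obtain \<alpha> s0 where \<alpha>: "\<forall>c\<in>C. (\<Sum>s<n. \<alpha> s * x s c) = 0" and s0: "s0 < n" "\<alpha> s0 \<noteq> 0"
    using dep by (auto simp: independent_rows_def)
  let ?M = "projected_mat n C x \<Phi>"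
  have "transpose_mat ?M *\<^sub>v vec n \<alpha> = 0\<^sub>v n"
  proof (rule eq_vecI)
    fix r assume "r < dim_vec (0\<^sub>v n :: 'a vec)"
    then have r: "r < n" by simp
    have "(transpose_mat ?M *\<^sub>v vec n \<alpha>) $ r = (\<Sum>s<n. (\<Sum>c\<in>C. x s c * \<Phi> r c) * \<alpha> s)"
      using r by (simp add: projected_mat_def scalar_prod_def atLeast0LessThan)
    also have "\<dots> = (\<Sum>s<n. \<Sum>c\<in>C. \<alpha> s * x s c * \<Phi> r c)"
      by (simp add: sum_distrib_left mult_ac del: sum.lessThan_Suc)
    also have "\<dots> = (\<Sum>c\<in>C. (\<Sum>s<n. \<alpha> s * x s c) * \<Phi> r c)"
      unfolding sum_distrib_right by (rule sum.swap)
    also have "\<dots> = 0" using \<alpha> by simp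
    finally show "(transpose_mat ?M *\<^sub>v vec n \<alpha>) $ r = 0\<^sub>v n $ r" using r by simp
  qed (simp add: projected_mat_def)
  moreover have "vec n \<alpha> \<noteq> 0\<^sub>v n" using s0 by (metis index_vec index_zero_vec(1))
  ultimately have "det (transpose_mat ?M) = 0"
    by (subst det_0_iff_vec_prod_zero[of _ n]) (auto intro!: exI[of _ "vec n \<alpha>"])
  then show ?thesis by (simp add: det_transpose[of _ n])
qed

section \<open>The bound for families of coordinate vectors\<close>

definition stacked_rows :: "nat \<Rightarrow> (nat \<Rightarrow> 'c \<Rightarrow> 'a) \<Rightarrow> (nat \<Rightarrow> 'c \<Rightarrow> 'a) \<Rightarrow> nat \<Rightarrow> 'c \<Rightarrow> 'a"
  where "stacked_rows p x y s = (if s < p then x s else y (s - p))"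

lemma sum_stacked_rows:
  "(\<Sum>s<p+q. \<alpha> s * stacked_rows p x y s c)
   = (\<Sum>s<p. \<alpha> s * x s c) + (\<Sum>s<q. \<alpha> (p + s) * y s c :: 'a::comm_ring_1)"
proof (induction q)
  case 0
  then show ?case by (simp add: stacked_rows_def)
next
  case (Suc q)
  then show ?case by (simp add: stacked_rows_def add.assoc)
qed

text \<open>
  Here \<open>w i a\<close> lists $\ell_a$ vectors spanning the space in row $i$ and column $a$, and \<open>E\<close> is the set of
  column pairs.  Expanding the product over \<open>E\<close> of the Laplace sums gives one sum over the choice functions
  that pick a column set for each pair; their number is the product of binomial coefficients.
\<close>

lemma skew_families_bound_infinite:
  fixes w :: "nat \<Rightarrow> 'j \<Rightarrow> nat \<Rightarrow> 'c \<Rightarrow> 'a::idom"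
  assumes inf: "infinite (UNIV :: 'a set)" and C: "finite C" and E: "finite E"
    and ind: "\<And>i a b. i < m \<Longrightarrow> (a, b) \<in> E \<Longrightarrow>
        independent_rows (l a + l b) C (stacked_rows (l a) (w i a) (w i b))"
    and dep: "\<And>i i'. i < i' \<Longrightarrow> i' < m \<Longrightarrow> \<exists>(a, b)\<in>E.
        \<not> independent_rows (l a + l b) C (stacked_rows (l a) (w i a) (w i' b))"
  shows "m \<le> (\<Prod>(a, b)\<in>E. (l a + l b) choose l a)"
proof -
  define D where "D \<Phi> e i i' = det (projected_mat (l (fst e) + l (snd e)) C
      (stacked_rows (l (fst e)) (w i (fst e)) (w i' (snd e))) \<Phi>)" for \<Phi> e i i'
  define F where "F e = {S. S \<subseteq> {0..<l (fst e) + l (snd e)} \<and> card S = l (fst e)}" for e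
  have "\<forall>e\<in>E. \<exists>\<Phi>. \<forall>i\<in>{..<m}. D \<Phi> e i i \<noteq> 0"
    unfolding D_def by (intro ballI exists_generic_projection[OF inf _ C]) (auto intro: ind)
  then obtain \<Phi> where \<Phi>: "\<And>e i. e \<in> E \<Longrightarrow> i < m \<Longrightarrow> D (\<Phi> e) e i i \<noteq> 0"
    by (metis lessThan_iff)
  have "\<forall>e. \<exists>X Y. \<forall>i i'. D (\<Phi> e) e i i' = (\<Sum>S\<in>F e. X i S * Y i' S)"
  proof
    fix e
    obtain u v where uv: "\<forall>A B :: nat \<Rightarrow> nat \<Rightarrow> 'a. det (mat (l (fst e) + l (snd e)) (l (fst e) + l (snd e))
        (\<lambda>(r, c). if r < l (fst e) then A r c else B (r - l (fst e)) c)) = (\<Sum>S\<in>F e. u A S * v B S)"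
      unfolding F_def using det_stack_eq_sum_of_products by blast
    let ?rows = "\<lambda>x r c. \<Sum>d\<in>C. x r d * \<Phi> e c d"
    have "D (\<Phi> e) e i i' = (\<Sum>S\<in>F e. u (?rows (w i (fst e))) S * v (?rows (w i' (snd e))) S)" for i i'
      unfolding D_def projected_mat_def uv[rule_format, symmetric]
      by (intro arg_cong[of _ _ det] eq_matI) (auto simp: stacked_rows_def)
    then show "\<exists>X Y. \<forall>i i'. D (\<Phi> e) e i i' = (\<Sum>S\<in>F e. X i S * Y i' S)"
      by (intro exI[of _ "\<lambda>i. u (?rows (w i (fst e)))"] exI[of _ "\<lambda>i'. v (?rows (w i' (snd e)))"] allI)
  qed
  then obtain X Y where XY: "\<And>e i i'. D (\<Phi> e) e i i' = (\<Sum>S\<in>F e. X e i S * Y e i' S)"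
    by metis
  have finF: "finite (F e)" for e by (simp add: F_def)
  have prodD: "(\<Prod>e\<in>E. D (\<Phi> e) e i i')
      = (\<Sum>g\<in>PiE E F. (\<Prod>e\<in>E. X e i (g e)) * (\<Prod>e\<in>E. Y e i' (g e)))" for i i'
    unfolding XY by (subst prod_sum_PiE[OF E finF]) (simp add: prod.distrib)
  have "m \<le> card (PiE E F)"
  proof (rule triangular_factorization_bound)
    show "finite (PiE E F)" using E finF by (intro finite_PiE) auto
    show "(\<Sum>g\<in>PiE E F. (\<Prod>e\<in>E. X e i (g e)) * (\<Prod>e\<in>E. Y e i (g e))) \<noteq> 0" if "i < m" for i
      unfolding prodD[symmetric] using \<Phi> that E by simp
    show "(\<Sum>g\<in>PiE E F. (\<Prod>e\<in>E. X e i (g e)) * (\<Prod>e\<in>E. Y e i' (g e))) = 0"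
      if "i < i'" "i' < m" for i i'
    proof -
      obtain e where "e \<in> E" "D (\<Phi> e) e i i' = 0"
        using dep[OF \<open>i < i'\<close> \<open>i' < m\<close>] det_projected_mat_dependent unfolding D_def by fastforce
      then show ?thesis unfolding prodD[symmetric] using E by (intro prod_zero) auto
    qed
  qed
  also have "card (PiE E F) = (\<Prod>e\<in>E. card (F e))" by (rule card_PiE[OF E])
  also have "\<dots> = (\<Prod>(a, b)\<in>E. (l a + l b) choose l a)"
    by (intro prod.cong) (auto simp: F_def n_subsets)
  finally show ?thesis .
qed

lemma infinite_UNIV_poly: "infinite (UNIV :: 'a::comm_ring_1 poly set)"
proof -
  have "inj (\<lambda>n. monom (1 :: 'a) n)" by (rule injI) (simp add: monom_eq_iff')
  then show ?thesis by (rule range_inj_infinite[THEN infinite_super[rotated]]) auto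
qed

text \<open>
  A relation with polynomial coefficients among constant vectors holds separately in each degree.
\<close>

lemma independent_rows_const_poly:
  fixes x :: "nat \<Rightarrow> 'c \<Rightarrow> 'a::idom"
  shows "independent_rows n C (\<lambda>s c. [:x s c:]) \<longleftrightarrow> independent_rows n C x"
proof
  assume ind: "independent_rows n C x"
  show "independent_rows n C (\<lambda>s c. [:x s c:])"
    unfolding independent_rows_def
  proof (intro allI impI)
    fix \<alpha> :: "nat \<Rightarrow> 'a poly" and s
    assume z: "\<forall>c\<in>C. (\<Sum>s<n. \<alpha> s * [:x s c:]) = 0" and s: "s < n"
    have "(\<Sum>s<n. coeff (\<alpha> s) j * x s c) = 0" if "c \<in> C" for j c
    proof -
      have "(\<Sum>s<n. coeff (\<alpha> s) j * x s c) = coeff (\<Sum>s<n. \<alpha> s * [:x s c:]) j"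
        by (simp add: coeff_sum mult.commute)
      then show ?thesis using z that by simp
    qed
    then have "coeff (\<alpha> s) j = 0" for j
      using ind[unfolded independent_rows_def, rule_format, of "\<lambda>s. coeff (\<alpha> s) j" s] s by simp
    then show "\<alpha> s = 0" by (simp add: poly_eq_iff)
  qed
next
  assume ind: "independent_rows n C (\<lambda>s c. [:x s c:])"
  show "independent_rows n C x"
    unfolding independent_rows_def
  proof (intro allI impI)
    fix \<alpha> :: "nat \<Rightarrow> 'a" and s
    assume z: "\<forall>c\<in>C. (\<Sum>s<n. \<alpha> s * x s c) = 0" and s: "s < n"
    have "(\<Sum>s<n. [:\<alpha> s:] * [:x s c:]) = [:\<Sum>s<n. \<alpha> s * x s c:]" for c
      by (induction n) auto
    with z have "\<forall>c\<in>C. (\<Sum>s<n. [:\<alpha> s:] * [:x s c:]) = 0" by simp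
    then have "[:\<alpha> s:] = 0"
      using ind[unfolded independent_rows_def, THEN spec[of _ "\<lambda>s. [:\<alpha> s:]"]] s by blast
    then show "\<alpha> s = 0" by simp
  qed
qed

lemma skew_families_bound:
  fixes w :: "nat \<Rightarrow> 'j \<Rightarrow> nat \<Rightarrow> 'c \<Rightarrow> 'a::idom"
  assumes C: "finite C" and E: "finite E"
    and ind: "\<And>i a b. i < m \<Longrightarrow> (a, b) \<in> E \<Longrightarrow>
        independent_rows (l a + l b) C (stacked_rows (l a) (w i a) (w i b))"
    and dep: "\<And>i i'. i < i' \<Longrightarrow> i' < m \<Longrightarrow> \<exists>(a, b)\<in>E.
        \<not> independent_rows (l a + l b) C (stacked_rows (l a) (w i a) (w i' b))"
  shows "m \<le> (\<Prod>(a, b)\<in>E. (l a + l b) choose l a)"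
proof (rule skew_families_bound_infinite[OF infinite_UNIV_poly C E,
      where w = "\<lambda>i a s c. [:w i a s c:]"])
  have const: "stacked_rows p (\<lambda>s c. [:x s c:]) (\<lambda>s c. [:y s c:])
      = (\<lambda>s c. [:stacked_rows p x y s c:])" for p and x y :: "nat \<Rightarrow> 'c \<Rightarrow> 'a"
    by (auto simp: stacked_rows_def fun_eq_iff)
  show "independent_rows (l a + l b) C (stacked_rows (l a)
      (\<lambda>s c. [:w i a s c:]) (\<lambda>s c. [:w i b s c:]))" if "i < m" "(a, b) \<in> E" for i a b
    using ind[OF that] by (simp only: const independent_rows_const_poly)
  show "\<exists>(a, b)\<in>E. \<not> independent_rows (l a + l b) C (stacked_rows (l a)
      (\<lambda>s c. [:w i a s c:]) (\<lambda>s c. [:w i' b s c:]))" if "i < i'" "i' < m" for i i'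
    using dep[OF that] by (simp only: const independent_rows_const_poly)
qed

section \<open>Coordinates for subspaces\<close>

definition (in vector_space) enumerates_basis :: "'b set \<Rightarrow> nat \<Rightarrow> (nat \<Rightarrow> 'b) \<Rightarrow> bool"
  where "enumerates_basis S d b \<longleftrightarrow>
    (\<forall>\<alpha>. (\<Sum>r<d. scale (\<alpha> r) (b r)) \<in> S) \<and> (\<forall>v\<in>S. \<exists>\<alpha>. v = (\<Sum>r<d. scale (\<alpha> r) (b r))) \<and>
    (\<forall>\<alpha>. (\<Sum>r<d. scale (\<alpha> r) (b r)) = 0 \<longrightarrow> (\<forall>r<d. \<alpha> r = 0))"

lemma (in vector_space) exists_enumerated_basis:
  assumes S: "subspace S" and dim: "dim_at_most scale S n"
  shows "\<exists>d b. d \<le> n \<and> enumerates_basis S d b"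
proof -
  obtain G where G: "finite G" "span G = S" and n: "dim S \<le> n"
    using dim by (auto simp: dim_at_most_def)
  obtain B where B: "B \<subseteq> S" "independent B" "S \<subseteq> span B" "card B = dim S"
    using basis_exists by blast
  have fB: "finite B" using independent_span_bound[OF G(1) B(2)] B(1) G(2) by simp
  have spB: "span B = S" using span_subspace[OF B(1) B(3) S] .
  obtain b where b: "bij_betw b {..<card B} B"
    using ex_bij_betw_nat_finite[OF fB] by (auto simp: atLeast0LessThan)
  have re: "(\<Sum>r<card B. scale (\<beta> (b r)) (b r)) = (\<Sum>v\<in>B. scale (\<beta> v) v)" for \<beta>
    by (rule sum.reindex_bij_betw[OF b])
  have bS: "b r \<in> S" if "r < card B" for r
    using b B(1) that by (auto simp: bij_betw_def)
  have "(\<Sum>r<card B. scale (\<alpha> r) (b r)) \<in> S" for \<alpha>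
    using bS by (intro subspace_sum[OF S] subspace_scale[OF S]) auto
  moreover have "\<exists>\<alpha>. v = (\<Sum>r<card B. scale (\<alpha> r) (b r))" if "v \<in> S" for v
  proof -
    have "v \<in> range (\<lambda>u. \<Sum>v\<in>B. scale (u v) v)"
      using that spB span_finite[OF fB] by simp
    then obtain \<beta> where "v = (\<Sum>v\<in>B. scale (\<beta> v) v)" by auto
    then have "v = (\<Sum>r<card B. scale ((\<beta> \<circ> b) r) (b r))" by (simp add: re)
    then show ?thesis by blast
  qed
  moreover have "\<alpha> r = 0" if z: "(\<Sum>r<card B. scale (\<alpha> r) (b r)) = 0" and r: "r < card B" for \<alpha> r
  proof -
    let ?i = "inv_into {..<card B} b"
    have i: "?i (b r) = r" if "r < card B" for r
      using b that by (auto simp: bij_betw_def)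
    have "(\<Sum>r<card B. scale (\<alpha> (?i (b r))) (b r)) = 0" using z by (simp add: i)
    then have "(\<Sum>v\<in>B. scale (\<alpha> (?i v)) v) = 0" unfolding re[of "\<alpha> \<circ> ?i", simplified] .
    then have "\<alpha> (?i (b r)) = 0"
      using independentD[OF B(2) fB order_refl] b r by (metis bij_betwE lessThan_iff)
    then show ?thesis by (simp add: i r)
  qed
  ultimately show ?thesis using B(4) n unfolding enumerates_basis_def by metis
qed

text \<open>
  Coordinates of the $r$-th vector of a basis $b_0, \dots, b_{d-1}$ of the space in column $a$, continued
  beyond $d$ by unit vectors.  The left summand of the index type carries the coordinates $\rho$ in the
  ambient space; the index \<open>Inr (a, r)\<close> belongs to the $r$-th filling vector of column $a$, and no other
  column uses it.
\<close>

definition padded_coords ::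
    "('v \<Rightarrow> 'v \<Rightarrow> 'f::field) \<Rightarrow> 'j \<Rightarrow> nat \<Rightarrow> (nat \<Rightarrow> 'v) \<Rightarrow> nat \<Rightarrow> 'v + 'j \<times> nat \<Rightarrow> 'f"
  where "padded_coords \<rho> a d b r c = (case c of
      Inl v \<Rightarrow> if r < d then \<rho> (b r) v else 0
    | Inr ar \<Rightarrow> if ar = (a, r) \<and> d \<le> r then 1 else 0)"

lemma sum_padded_coords_Inr:
  "(\<Sum>r<n. \<alpha> r * padded_coords \<rho> a d b r (Inr (a', r')))
   = (if a' = a \<and> d \<le> r' \<and> r' < n then \<alpha> r' else 0)"
proof -
  have "(\<Sum>r<n. \<alpha> r * padded_coords \<rho> a d b r (Inr (a', r')))
     = (\<Sum>r<n. if r = r' then (if a' = a \<and> d \<le> r' then \<alpha> r' else 0) else 0)"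
    by (intro sum.cong) (auto simp: padded_coords_def)
  also have "\<dots> = (if a' = a \<and> d \<le> r' \<and> r' < n then \<alpha> r' else 0)"
    by (simp add: sum.delta)
  finally show ?thesis .
qed

context vector_space
begin

lemma sum_padded_coords_Inl:
  assumes B: "independent B" and S: "enumerates_basis S d b" "S \<subseteq> span B" and d: "d \<le> n"
  shows "(\<Sum>r<n. \<alpha> r * padded_coords (representation B) a d b r (Inl v))
       = representation B (\<Sum>r<d. scale (\<alpha> r) (b r)) v"
proof -
  have bB: "b r \<in> span B" if r: "r < d" for r
  proof -
    have "(\<Sum>r'<d. scale (if r' = r then 1 else 0) (b r')) = (\<Sum>r'<d. if r' = r then b r' else 0)"
      by (intro sum.cong) auto
    also have "\<dots> = b r" using r by (simp add: sum.delta)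
    finally show ?thesis using S unfolding enumerates_basis_def by (metis subsetD)
  qed
  have "(\<Sum>r<n. \<alpha> r * padded_coords (representation B) a d b r (Inl v))
      = (\<Sum>r<d. \<alpha> r * representation B (b r) v)"
    using d by (intro sum.mono_neutral_cong_right) (auto simp: padded_coords_def)
  also have "\<dots> = representation B (\<Sum>r<d. scale (\<alpha> r) (b r)) v"
    by (subst representation_sum[OF B]) (auto simp: bB span_scale representation_scale[OF B])
  finally show ?thesis .
qed

text \<open>
  In a vanishing combination the new coordinates force the coefficients of the filling vectors to be
  zero, because the labels $a \ne a'$ keep them apart.  What remains is an equation $x = -y$ with
  $x \in S$ and $y \in T$.  Conversely, a nonzero vector in $S \cap T$, written in both
  bases, gives a nontrivial relation.
\<close>

lemma independent_padded_coords_iff: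
  assumes B: "independent B" "finite B"
    and S: "enumerates_basis S d b" "S \<subseteq> span B" "d \<le> p" "subspace S"
    and T: "enumerates_basis T d' b'" "T \<subseteq> span B" "d' \<le> q" "subspace T"
    and ne: "a \<noteq> a'"
    and C: "C = Inl ` B \<union> Inr ` P" "{a} \<times> {..<p} \<subseteq> P" "{a'} \<times> {..<q} \<subseteq> P"
  shows "independent_rows (p + q) C (stacked_rows p
      (padded_coords (representation B) a d b) (padded_coords (representation B) a' d' b'))
    \<longleftrightarrow> disjoint_subspaces S T" (is "independent_rows _ _ ?w \<longleftrightarrow> _")
proof -
  let ?x = "\<lambda>\<alpha>. \<Sum>r<d. scale (\<alpha> r) (b r)"
  let ?y = "\<lambda>\<alpha>. \<Sum>r<d'. scale (\<alpha> (p + r)) (b' r)"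
  have xS: "?x \<alpha> \<in> S" and yT: "?y \<alpha> \<in> T" for \<alpha>
    using S(1) T(1)[unfolded enumerates_basis_def, THEN conjunct1, rule_format, of "\<lambda>r. \<alpha> (p + r)"]
    by (auto simp: enumerates_basis_def)
  have comb_Inl: "(\<Sum>s<p+q. \<alpha> s * ?w s (Inl v)) = representation B (?x \<alpha> + ?y \<alpha>) v" for \<alpha> v
    using xS yT S(2) T(2)
    by (simp add: sum_stacked_rows sum_padded_coords_Inl[OF B(1) S(1-3)]
        sum_padded_coords_Inl[OF B(1) T(1-3)] representation_add[OF B(1)] subset_iff)
  have comb_Inr: "(\<Sum>s<p+q. \<alpha> s * ?w s (Inr (c, r)))
      = (if c = a \<and> d \<le> r \<and> r < p then \<alpha> r else 0)
      + (if c = a' \<and> d' \<le> r \<and> r < q then \<alpha> (p + r) else 0)" for \<alpha> c r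
    by (simp only: sum_stacked_rows sum_padded_coords_Inr)
  show ?thesis
  proof
    assume disj: "disjoint_subspaces S T"
    show "independent_rows (p + q) C ?w"
      unfolding independent_rows_def
    proof (intro allI impI)
      fix \<alpha> s assume z: "\<forall>c\<in>C. (\<Sum>s<p+q. \<alpha> s * ?w s c) = 0" and s: "s < p + q"
      have pad: "\<alpha> r = 0" if "d \<le> r" "r < p" for r
        using z[rule_format, of "Inr (a, r)"] that C ne by (auto simp: comb_Inr)
      have pad': "\<alpha> (p + r) = 0" if "d' \<le> r" "r < q" for r
        using z[rule_format, of "Inr (a', r)"] that C ne by (auto simp: comb_Inr)
      have "?x \<alpha> + ?y \<alpha> \<in> span B"
        using span_add subsetD[OF S(2) xS] subsetD[OF T(2) yT] by blast
      then have "?x \<alpha> + ?y \<alpha> = (\<Sum>v\<in>B. scale (representation B (?x \<alpha> + ?y \<alpha>) v) v)"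
        using B by (intro sum_representation_eq[symmetric]) auto
      also have "\<dots> = 0"
      proof (rule sum.neutral, rule ballI)
        fix v assume "v \<in> B"
        then have "representation B (?x \<alpha> + ?y \<alpha>) v = 0"
          unfolding comb_Inl[symmetric] using z C(1) by blast
        then show "scale (representation B (?x \<alpha> + ?y \<alpha>) v) v = 0" by simp
      qed
      finally have xy: "?x \<alpha> = - ?y \<alpha>" by (simp add: eq_neg_iff_add_eq_0)
      then have "?x \<alpha> \<in> S \<inter> T" using xS[of \<alpha>] subspace_neg[OF T(4) yT[of \<alpha>]] by simp
      then have x0: "?x \<alpha> = 0" using disj unfolding disjoint_subspaces_def by blast
      then have y0: "?y \<alpha> = 0" using xy by simp
      have "\<alpha> r = 0" if "r < d" for r
        using x0 S(1) that unfolding enumerates_basis_def by blast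
      moreover have "\<alpha> (p + r) = 0" if "r < d'" for r
        using T(1)[unfolded enumerates_basis_def, THEN conjunct2, THEN conjunct2,
            THEN spec[of _ "\<lambda>r. \<alpha> (p + r)"]] y0 that by blast
      ultimately have "\<alpha> r = 0" if "r < p" for r using pad that by (meson not_le)
      moreover have "\<alpha> (p + r) = 0" if "r < q" for r
        using pad' \<open>\<And>r. r < d' \<Longrightarrow> \<alpha> (p + r) = 0\<close> that by (meson not_le)
      ultimately show "\<alpha> s = 0" using s
        by (metis add_diff_inverse_nat add_less_cancel_left)
    qed
  next
    assume ind: "independent_rows (p + q) C ?w"
    have "z = 0" if zS: "z \<in> S" and zT: "z \<in> T" for z
    proof -
      obtain \<beta> \<gamma> where \<beta>: "z = (\<Sum>r<d. scale (\<beta> r) (b r))" and \<gamma>: "z = (\<Sum>r<d'. scale (\<gamma> r) (b' r))"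
        using zS zT S(1) T(1) unfolding enumerates_basis_def by meson
      define \<alpha> where "\<alpha> s = (if s < p then if s < d then \<beta> s else 0
          else if s - p < d' then - \<gamma> (s - p) else 0)" for s
      have x: "?x \<alpha> = z" using S(3) by (auto simp: \<alpha>_def \<beta> intro!: sum.cong)
      have "?y \<alpha> = - z" by (simp add: \<alpha>_def \<gamma> sum_negf)
      then have "(\<Sum>s<p+q. \<alpha> s * ?w s (Inl v)) = 0" for v
        by (simp add: comb_Inl x representation_zero)
      moreover have "(\<Sum>s<p+q. \<alpha> s * ?w s (Inr (c, r))) = 0" for c r
        by (simp add: comb_Inr) (simp add: \<alpha>_def)
      ultimately have "\<forall>c\<in>C. (\<Sum>s<p+q. \<alpha> s * ?w s c) = 0"
        by (metis sum.exhaust prod.exhaust)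
      then have "\<forall>s<p+q. \<alpha> s = 0" using ind unfolding independent_rows_def by blast
      then have "?x \<alpha> = 0" using S(3) by (intro sum.neutral) auto
      then show "z = 0" using x by simp
    qed
    then show "disjoint_subspaces S T"
      using subspace_0[OF S(4)] subspace_0[OF T(4)] by (auto simp: disjoint_subspaces_def)
  qed
qed

lemma exists_common_finite_basis:
  assumes I: "finite I" and dim: "\<And>i. i \<in> I \<Longrightarrow> dim_at_most scale (S i) (n i)"
  shows "\<exists>B. finite B \<and> independent B \<and> (\<forall>i\<in>I. S i \<subseteq> span B)"
proof -
  obtain G where G: "\<And>i. i \<in> I \<Longrightarrow> finite (G i) \<and> span (G i) = S i"
    using dim unfolding dim_at_most_def by metis
  obtain B where B: "B \<subseteq> (\<Union>i\<in>I. G i)" "independent B" "(\<Union>i\<in>I. G i) \<subseteq> span B"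
    using maximal_independent_subset by blast
  have "finite B" using B(1) I G by (auto intro: finite_subset)
  moreover have "S i \<subseteq> span B" if "i \<in> I" for i
    using G[OF that] B(3) that span_minimal[OF _ subspace_span, of "G i" B] by auto
  ultimately show ?thesis using B(2) by blast
qed

end

section \<open>The bound\<close>

text \<open>
  Each index lies in $k - 1$ of the pairs.
\<close>

lemma prod_ordered_pairs:
  fixes f :: "nat \<Rightarrow> 'a::comm_semiring_1"
  shows "(\<Prod>(a, b)\<in>{(a, b). 1 \<le> a \<and> a < b \<and> b \<le> k}. f a * f b) = (\<Prod>r\<in>{1..k}. f r) ^ (k - 1)"
proof (induction k)
  case 0
  have "{(a, b). 1 \<le> a \<and> a < b \<and> b \<le> (0::nat)} = {}" by auto
  then show ?case by (simp only: prod.empty) simp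
next
  case (Suc k)
  let ?E = "\<lambda>k. {(a, b). 1 \<le> a \<and> a < b \<and> b \<le> (k::nat)}"
  have fin: "finite (?E k)" by (rule finite_subset[of _ "{1..k} \<times> {1..k}"]) auto
  have split: "?E (Suc k) = ?E k \<union> (\<lambda>a. (a, Suc k)) ` {1..k}" by (auto simp: le_Suc_eq)
  have "(\<Prod>(a, b)\<in>?E (Suc k). f a * f b)
      = (\<Prod>(a, b)\<in>?E k. f a * f b) * (\<Prod>(a, b)\<in>(\<lambda>a. (a, Suc k)) ` {1..k}. f a * f b)"
    unfolding split by (rule prod.union_disjoint) (use fin in auto)
  also have "(\<Prod>(a, b)\<in>(\<lambda>a. (a, Suc k)) ` {1..k}. f a * f b) = (\<Prod>a\<in>{1..k}. f a) * f (Suc k) ^ k"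
    by (subst prod.reindex) (auto simp: inj_on_def prod.distrib)
  also have "(\<Prod>(a, b)\<in>?E k. f a * f b) * \<dots> = ((\<Prod>r\<in>{1..k}. f r) * f (Suc k)) ^ k"
    unfolding Suc.IH by (cases k) (simp_all add: power_mult_distrib mult_ac)
  finally show ?case by simp
qed

theorem theorem4:
  fixes scale :: "'f::field \<Rightarrow> 'v::ab_group_add \<Rightarrow> 'v"
    and k m :: nat
    and l :: "nat \<Rightarrow> nat"
    and U :: "nat \<Rightarrow> nat \<Rightarrow> 'v set"
  assumes "vector_space scale"
    and "k > 0" and "m > 0"
    and "\<And>j. j \<in> {1..k} \<Longrightarrow> l j > 0"
    and "\<And>i j. i \<in> {1..m} \<Longrightarrow> j \<in> {1..k} \<Longrightarrow> module.subspace scale (U i j)"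
    and "\<And>i j. i \<in> {1..m} \<Longrightarrow> j \<in> {1..k} \<Longrightarrow> dim_at_most scale (U i j) (l j)"
    and "\<And>i j j'. i \<in> {1..m} \<Longrightarrow> j \<in> {1..k} \<Longrightarrow> j' \<in> {1..k} \<Longrightarrow> j \<noteq> j'
           \<Longrightarrow> disjoint_subspaces (U i j) (U i j')"
    and "\<And>i i'. 1 \<le> i \<Longrightarrow> i < i' \<Longrightarrow> i' \<le> m
           \<Longrightarrow> \<exists>j j'. 1 \<le> j \<and> j < j' \<and> j' \<le> k \<and> \<not> disjoint_subspaces (U i j) (U i' j')"
  shows "real m \<le> (\<Prod>(a, b)\<in>{(a, b). 1 \<le> a \<and> a < b \<and> b \<le> k}. fact (l a + l b))
                   / (\<Prod>r\<in>{1..k}. fact (l r)) ^ (k - 1)"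
proof -
  interpret vector_space scale by fact
  let ?E = "{(a, b). 1 \<le> a \<and> a < b \<and> b \<le> k}"
  have E: "finite ?E" by (rule finite_subset[of _ "{1..k} \<times> {1..k}"]) auto
  have "\<forall>ij\<in>{1..m}\<times>{1..k}. \<exists>db. fst db \<le> l (snd ij)
      \<and> enumerates_basis (U (fst ij) (snd ij)) (fst db) (snd db)"
    using exists_enumerated_basis assms(5,6) by fastforce
  then obtain db where db: "\<forall>ij\<in>{1..m}\<times>{1..k}. fst (db ij) \<le> l (snd ij)
      \<and> enumerates_basis (U (fst ij) (snd ij)) (fst (db ij)) (snd (db ij))"
    by metis
  obtain B where B: "finite B" "independent B" "\<forall>ij\<in>{1..m}\<times>{1..k}. U (fst ij) (snd ij) \<subseteq> span B"
    using exists_common_finite_basis[of "{1..m}\<times>{1..k}" "\<lambda>ij. U (fst ij) (snd ij)" "\<lambda>ij. l (snd ij)"]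
      assms(6) by auto
  \<comment> \<open>the filling coordinates that the columns need\<close>
  define P where "P = (SIGMA j:{1..k}. {..<l j})"
  define C :: "('v + nat \<times> nat) set" where "C = Inl ` B \<union> Inr ` P"
  \<comment> \<open>rows are counted from 0 here, hence the successor\<close>
  define w where "w i j = padded_coords (representation B) j (fst (db (Suc i, j))) (snd (db (Suc i, j)))" for i j
  have iff: "independent_rows (l a + l b) C (stacked_rows (l a) (w i a) (w i' b))
      \<longleftrightarrow> disjoint_subspaces (U (Suc i) a) (U (Suc i') b)"
    if "i < m" "i' < m" "(a, b) \<in> ?E" for i i' a b
  proof -
    have ab: "a \<in> {1..k}" "b \<in> {1..k}" "a \<noteq> b" and ii: "Suc i \<in> {1..m}" "Suc i' \<in> {1..m}"
      using that by auto
    have row: "enumerates_basis (U r c) (fst (db (r, c))) (snd (db (r, c)))" "U r c \<subseteq> span B"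
        "fst (db (r, c)) \<le> l c" "subspace (U r c)" if "r \<in> {1..m}" "c \<in> {1..k}" for r c
      using db[rule_format, of "(r, c)"] B(3)[rule_format, of "(r, c)"] assms(5)[of r c] that by simp_all
    have P: "{a} \<times> {..<l a} \<subseteq> P" "{b} \<times> {..<l b} \<subseteq> P"
      using ab by (auto simp: P_def)
    show ?thesis
      unfolding w_def
      by (rule independent_padded_coords_iff[OF B(2,1) row[OF ii(1) ab(1)] row[OF ii(2) ab(2)] ab(3)
            C_def P])
  qed
  have "m \<le> (\<Prod>(a, b)\<in>?E. (l a + l b) choose l a)"
  proof (rule skew_families_bound[OF _ E, where w = w and C = C])
    show "finite C" using B(1) by (simp add: C_def P_def)
    show "independent_rows (l a + l b) C (stacked_rows (l a) (w i a) (w i b))"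
      if "i < m" "(a, b) \<in> ?E" for i a b
      using that assms(7)[of "Suc i" a b] by (subst iff) auto
    show "\<exists>(a, b)\<in>?E. \<not> independent_rows (l a + l b) C (stacked_rows (l a) (w i a) (w i' b))"
      if "i < i'" "i' < m" for i i'
    proof -
      obtain a b where "(a, b) \<in> ?E" "\<not> disjoint_subspaces (U (Suc i) a) (U (Suc i') b)"
        using assms(8)[of "Suc i" "Suc i'"] \<open>i < i'\<close> \<open>i' < m\<close> by auto
      then show ?thesis using iff[of i i' a b] that by (intro bexI[of _ "(a, b)"]) auto
    qed
  qed
  then have "real m \<le> real (\<Prod>(a, b)\<in>?E. (l a + l b) choose l a)" by (simp only: of_nat_le_iff)
  also have "\<dots> = (\<Prod>(a, b)\<in>?E. fact (l a + l b) / (fact (l a) * fact (l b)))"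
    by (simp add: of_nat_prod case_prod_unfold binomial_fact)
  also have "\<dots> = (\<Prod>(a, b)\<in>?E. fact (l a + l b)) / (\<Prod>(a, b)\<in>?E. fact (l a) * fact (l b))"
    by (simp add: case_prod_unfold prod_dividef)
  also have "(\<Prod>(a, b)\<in>?E. fact (l a) * fact (l b)) = (\<Prod>r\<in>{1..k}. fact (l r) :: real) ^ (k - 1)"
    by (rule prod_ordered_pairs)
  finally show ?thesis .
qed

end
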